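(* Consider the Gaussian white noise model. Let the function class $\mathcal{F}$ be a subset of the direct sum of spaces $\mathcal{F}_1,\ldots,\mathcal{F}_p$ of functions $\mathbf{R}^d\to\mathbf{R}$ in $L_2(\mathbf{R}^d)$. Let $\mathcal{F}_\delta$ be a finite $\delta$-net of $\mathcal{F}$ that is a subset of the direct sum $\mathcal{F}_{1,\delta}\oplus\cdots\oplus\mathcal{F}_{p,\delta}$, where each $\mathcal{F}_{j,\delta}$ is a finite subset of $\mathcal{F}_j$. Denote the number of elements of $\mathcal{F}_{j,\delta}$ by $\exp(\lambda_j)$ and write $\rho_j=\varrho(Q,\mathcal{F}_{j,\delta})$. Assume that, for a constant $c>0$, $$\|f_1+\cdots+f_p\|_2^2\ge c\sum_{j=1}^p\|f_j\|_2^2$$ for all $f_1,\ldots,f_p$ such that each $f_j$ is a difference of two elements of $\mathcal{F}_j$. Let $\hat f=\arg\min_{\phi\in\mathcal{F}_\delta}\gamma_n(\phi)$ be the $\delta$-net minimizer over $\mathcal{F}_\delta$. Then, for $f\in\mathcal{F}$, $$E(\|\hat f-f\|_2^2)\le3\delta^2+32c^{-1}n^{-1}\Big[\sum_{j=1}^p\rho_j^2\lambda_j+\Big(\sum_{j=1}^p\rho_j\Big)^2\Big].$$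
   Context: Setting. $(\mathbf{Y},\mathcal{Y},\nu)$ is a Borel space and $A:L_2(\mathbf{R}^d)\to L_2(\mathbf{Y})$ is a known linear operator ($L_2(\mathbf{R}^d)$ with respect to Lebesgue measure, $L_2(\mathbf{Y})$ with respect to $\nu$; $\|\cdot\|_2$ is the $L_2$-norm). $Q=(A^{-1})^*$ is the adjoint of the inverse of $A$, with domain $L_2(\mathbf{R}^d)$: $\int_{\mathbf{R}^d}(A^{-1}h)g=\int_{\mathbf{Y}}h\,(Qg)\,d\nu$ for $h\in L_2(\mathbf{Y})$, $g\in L_2(\mathbf{R}^d)$. Gaussian white noise model: one observes $dY_n(y)=(Af)(y)\,dy+n^{-1/2}dW(y)$, $y\in\mathbf{Y}$, i.e. $\int h\,dY_n=\int_{\mathbf{Y}}h\,(Af)\,d\nu+n^{-1/2}\int h\,dW$ for $h\in L_2(\mathbf{Y})$, where for $h_1,h_2\in L_2(\mathbf{Y})$ the vector $(\int h_1dW,\int h_2dW)$ is mean-zero Gaussian with variances $\|h_1\|_2^2,\|h_2\|_2^2$ and covariance $\int_{\mathbf{Y}}h_1h_2\,d\nu$; $f$ is the unknown signal function. Empirical risk: $\gamma_n(g)=-2\int_{\mathbf{Y}}(Qg)\,dY_n+\|g\|_2^2$. $\mathcal{F}_\delta$ is a $\delta$-net of $\mathcal{F}$: for each $f\in\mathcal{F}$ there is $\phi\in\mathcal{F}_\delta$ with $\|f-\phi\|_2\le\delta$. For a finite set $\mathcal{H}\subset L_2(\mathbf{R}^d)$ (understood to have at least two elements), $\varrho(Q,\mathcal{H})=\max_{\phi,\phi'\in\mathcal{H},\,\phi\ne\phi'}\|Q(\phi-\phi')\|_2/\|\phi-\phi'\|_2$.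 The direct sum of sets of functions is the set of sums $f_1+\cdots+f_p$ with $f_j$ in the $j$th set. It is not assumed that functions in $\mathcal{F}_j$ depend only on the $j$th coordinate. *)

theory Defs
  imports "HOL-Probability.Probability"
begin

text \<open>
  Elements of \<open>L\<^sub>2\<close> are represented by measurable square-integrable functions rather than by
  classes modulo null sets. Operators on \<open>L\<^sub>2\<close> are accordingly required to respect equality
  almost everywhere, and identities between their values hold almost everywhere.
\<close>

definition L2 :: "'a measure \<Rightarrow> ('a \<Rightarrow> real) set" where
  "L2 M = {f \<in> borel_measurable M. integrable M (\<lambda>x. (f x)\<^sup>2)}"

definition L2norm :: "'a measure \<Rightarrow> ('a \<Rightarrow> real) \<Rightarrow> real" where
  "L2norm M f = sqrt (\<integral>x. (f x)\<^sup>2 \<partial>M)"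

definition L2_operator ::
    "'a measure \<Rightarrow> 'b measure \<Rightarrow> (('a \<Rightarrow> real) \<Rightarrow> ('b \<Rightarrow> real)) \<Rightarrow> bool" where
  "L2_operator M N T \<longleftrightarrow>
     (\<forall>f\<in>L2 M. T f \<in> L2 N) \<and>
     (\<forall>f\<in>L2 M. \<forall>g\<in>L2 M. (AE x in M. f x = g x) \<longrightarrow> (AE y in N. T f y = T g y))"

definition L2_linear_operator ::
    "'a measure \<Rightarrow> 'b measure \<Rightarrow> (('a \<Rightarrow> real) \<Rightarrow> ('b \<Rightarrow> real)) \<Rightarrow> bool" where
  "L2_linear_operator M N T \<longleftrightarrow>
     L2_operator M N T \<and>
     (\<forall>f\<in>L2 M. \<forall>g\<in>L2 M. \<forall>a b :: real.
        AE y in N. T (\<lambda>x. a * f x + b * g x) y = a * T f y + b * T g y)"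

definition L2_inverse ::
    "'a measure \<Rightarrow> 'b measure \<Rightarrow> (('a \<Rightarrow> real) \<Rightarrow> ('b \<Rightarrow> real)) \<Rightarrow>
       (('b \<Rightarrow> real) \<Rightarrow> ('a \<Rightarrow> real)) \<Rightarrow> bool" where
  "L2_inverse M N A B \<longleftrightarrow>
     L2_operator N M B \<and>
     (\<forall>f\<in>L2 M. AE x in M. B (A f) x = f x) \<and>
     (\<forall>h\<in>L2 N. AE y in N. A (B h) y = h y)"

text \<open>\<open>S\<close> is the adjoint, with domain all of \<open>L2 M\<close>, of the operator \<open>T\<close> from \<open>L2 N\<close> to \<open>L2 M\<close>.\<close>

definition L2_adjoint ::
    "'b measure \<Rightarrow> 'a measure \<Rightarrow> (('b \<Rightarrow> real) \<Rightarrow> ('a \<Rightarrow> real)) \<Rightarrow>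
       (('a \<Rightarrow> real) \<Rightarrow> ('b \<Rightarrow> real)) \<Rightarrow> bool" where
  "L2_adjoint N M T S \<longleftrightarrow>
     L2_operator M N S \<and>
     (\<forall>h\<in>L2 N. \<forall>g\<in>L2 M. (\<integral>x. T h x * g x \<partial>M) = (\<integral>y. h y * S g y \<partial>N))"

text \<open>Degenerate (almost surely constant) random variables count as Gaussian.\<close>

definition gaussian_rv :: "'w measure \<Rightarrow> ('w \<Rightarrow> real) \<Rightarrow> bool" where
  "gaussian_rv M X \<longleftrightarrow>
     X \<in> borel_measurable M \<and>
     ((\<exists>m. AE \<omega> in M. X \<omega> = m) \<or>
      (\<exists>m \<sigma>. \<sigma> > 0 \<and> distributed M lborel X (\<lambda>x. ennreal (normal_density m \<sigma> x))))"

definition gaussian_vector2 :: "'w measure \<Rightarrow> ('w \<Rightarrow> real) \<Rightarrow> ('w \<Rightarrow> real) \<Rightarrow> bool" where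
  "gaussian_vector2 M X Y \<longleftrightarrow> (\<forall>a b. gaussian_rv M (\<lambda>\<omega>. a * X \<omega> + b * Y \<omega>))"

text \<open>\<open>W h\<close> is the stochastic integral \<open>\<integral> h dW\<close>.\<close>

definition white_noise ::
    "'w measure \<Rightarrow> 'b measure \<Rightarrow> (('b \<Rightarrow> real) \<Rightarrow> 'w \<Rightarrow> real) \<Rightarrow> bool" where
  "white_noise M N W \<longleftrightarrow>
     (\<forall>h1\<in>L2 N. \<forall>h2\<in>L2 N.
        gaussian_vector2 M (W h1) (W h2) \<and>
        (\<integral>\<omega>. W h1 \<omega> \<partial>M) = 0 \<and> (\<integral>\<omega>. W h2 \<omega> \<partial>M) = 0 \<and>
        prob_space.variance M (W h1) = (L2norm N h1)\<^sup>2 \<and>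
        prob_space.variance M (W h2) = (L2norm N h2)\<^sup>2 \<and>
        (\<integral>\<omega>. W h1 \<omega> * W h2 \<omega> \<partial>M) = (\<integral>y. h1 y * h2 y \<partial>N))"

text \<open>The observed integral \<open>\<integral> h dY\<^sub>n\<close>; the argument \<open>Af\<close> is the image of the signal.\<close>

definition obs_integral ::
    "'b measure \<Rightarrow> (('b \<Rightarrow> real) \<Rightarrow> 'w \<Rightarrow> real) \<Rightarrow> nat \<Rightarrow> ('b \<Rightarrow> real) \<Rightarrow>
       ('b \<Rightarrow> real) \<Rightarrow> 'w \<Rightarrow> real" where
  "obs_integral N W n Af h \<omega> =
     (\<integral>y. h y * Af y \<partial>N) + real n powr (- 1 / 2) * W h \<omega>"

definition empirical_risk ::
    "'a measure \<Rightarrow> (('a \<Rightarrow> real) \<Rightarrow> ('b \<Rightarrow> real)) \<Rightarrow> (('b \<Rightarrow> real) \<Rightarrow> 'w \<Rightarrow> real) \<Rightarrow>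
       ('a \<Rightarrow> real) \<Rightarrow> 'w \<Rightarrow> real" where
  "empirical_risk M Q dY g \<omega> = - 2 * dY (Q g) \<omega> + (L2norm M g)\<^sup>2"

definition delta_net ::
    "'a measure \<Rightarrow> real \<Rightarrow> ('a \<Rightarrow> real) set \<Rightarrow> ('a \<Rightarrow> real) set \<Rightarrow> bool" where
  "delta_net M \<delta> F H \<longleftrightarrow> (\<forall>f\<in>F. \<exists>\<phi>\<in>H. L2norm M (\<lambda>x. f x - \<phi> x) \<le> \<delta>)"

text \<open>
  Meant for finite \<open>H\<close> with at least two elements. If \<open>H\<close> contains two different
  representatives of the same element of \<open>L2 M\<close>, then that pair contributes \<open>z / 0 = 0\<close>.
\<close>

definition varrho ::
    "'a measure \<Rightarrow> 'b measure \<Rightarrow> (('a \<Rightarrow> real) \<Rightarrow> ('b \<Rightarrow> real)) \<Rightarrow> ('a \<Rightarrow> real) set \<Rightarrow> real" where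
  "varrho M N Q H =
     Max {L2norm N (Q (\<lambda>x. \<phi> x - \<psi> x)) / L2norm M (\<lambda>x. \<phi> x - \<psi> x) | \<phi> \<psi>.
            \<phi> \<in> H \<and> \<psi> \<in> H \<and> \<phi> \<noteq> \<psi>}"

definition direct_sum :: "nat \<Rightarrow> (nat \<Rightarrow> ('a \<Rightarrow> real) set) \<Rightarrow> ('a \<Rightarrow> real) set" where
  "direct_sum p F = {(\<lambda>x. \<Sum>j=1..p. g j x) | g. \<forall>j\<in>{1..p}. g j \<in> F j}"

end

(*
  By the adjoint relation, the empirical risk of g at the signal f is
  |g - f|^2 - |f|^2 - 2 n^(-1/2) W(Qg). Comparing the minimizer with a net point phi at distance
  at most delta from f bounds |fhat - f|^2 by delta^2 plus the noise term
  2 n^(-1/2) W(Q(fhat - phi)). That term splits over the p components; the j-th part is at most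
  rho_j |fhat_j - phi_j| times a normalized Gaussian out of a family indexed by the j-th net.
  The assumption with the constant c and Young's inequality absorb the norms |fhat_j - phi_j| into
  the left side. What remains are expected maxima of exp(lambda_j) squared Gaussians of variance
  at most 1, and these are at most 4 (lambda_j + 1) because E exp(Z^2 / 4) = sqrt 2.
*)

theory Submission
  imports Defs
begin

section \<open>Square-integrable functions\<close>

lemma L2_mult_integrable:
  assumes "f \<in> L2 M" "g \<in> L2 M"
  shows "integrable M (\<lambda>x. f x * g x)"
proof (rule Bochner_Integration.integrable_bound[where f = "\<lambda>x. (f x)\<^sup>2 + (g x)\<^sup>2"])
  show "integrable M (\<lambda>x. (f x)\<^sup>2 + (g x)\<^sup>2)"
    using assms unfolding L2_def by auto
  show "(\<lambda>x. f x * g x) \<in> borel_measurable M"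
    using assms unfolding L2_def by auto
  have "norm (a * b) \<le> norm (a\<^sup>2 + b\<^sup>2)" for a b :: real
  proof -
    have "2 * \<bar>a * b\<bar> \<le> a\<^sup>2 + b\<^sup>2"
      using zero_le_power2[of "\<bar>a\<bar> - \<bar>b\<bar>"] by (simp add: power2_diff abs_mult)
    then show ?thesis by simp
  qed
  then show "AE x in M. norm (f x * g x) \<le> norm ((f x)\<^sup>2 + (g x)\<^sup>2)" by simp
qed

lemma L2_lincomb:
  assumes "f \<in> L2 M" "g \<in> L2 M"
  shows "(\<lambda>x. a * f x + b * g x) \<in> L2 M"
proof -
  have "integrable M (\<lambda>x. a\<^sup>2 * (f x * f x) + 2 * a * b * (f x * g x) + b\<^sup>2 * (g x * g x))"
    using L2_mult_integrable[OF assms] L2_mult_integrable[OF assms(1,1)]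
      L2_mult_integrable[OF assms(2,2)] by auto
  moreover have "(\<lambda>x. a\<^sup>2 * (f x * f x) + 2 * a * b * (f x * g x) + b\<^sup>2 * (g x * g x))
      = (\<lambda>x. (a * f x + b * g x)\<^sup>2)"
    by (auto simp: power2_eq_square algebra_simps)
  ultimately show ?thesis
    using assms unfolding L2_def by auto
qed

lemma L2_diff: "f \<in> L2 M \<Longrightarrow> g \<in> L2 M \<Longrightarrow> (\<lambda>x. f x - g x) \<in> L2 M"
  using L2_lincomb[of f M g 1 "-1"] by simp

lemma L2_sum: "(\<And>j. j \<in> J \<Longrightarrow> g j \<in> L2 M) \<Longrightarrow> (\<lambda>x. \<Sum>j\<in>J. g j x) \<in> L2 M"
proof (induction J rule: infinite_finite_induct)
  case (insert j J)
  then show ?case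
    using L2_lincomb[of "g j" M "\<lambda>x. \<Sum>j\<in>J. g j x" 1 1] by simp
qed (simp_all add: L2_def)

lemma L2_integrable_square: "f \<in> L2 M \<Longrightarrow> integrable M (\<lambda>x. (f x)\<^sup>2)"
  by (simp add: L2_def)

lemma L2norm_square: "(L2norm M f)\<^sup>2 = (\<integral>x. (f x)\<^sup>2 \<partial>M)"
  unfolding L2norm_def by (simp add: integral_nonneg_AE)

lemma L2norm_nonneg [simp]: "0 \<le> L2norm M f"
  unfolding L2norm_def by (simp add: integral_nonneg_AE)

lemma L2norm_diff_square:
  assumes "f \<in> L2 M" "g \<in> L2 M"
  shows "(L2norm M (\<lambda>x. f x - g x))\<^sup>2
    = (L2norm M f)\<^sup>2 - 2 * (\<integral>x. f x * g x \<partial>M) + (L2norm M g)\<^sup>2"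
proof -
  have "(\<integral>x. (f x - g x)\<^sup>2 \<partial>M) = (\<integral>x. (f x)\<^sup>2 - 2 * (f x * g x) + (g x)\<^sup>2 \<partial>M)"
    by (simp add: power2_diff algebra_simps)
  also have "\<dots> = (\<integral>x. (f x)\<^sup>2 \<partial>M) - 2 * (\<integral>x. f x * g x \<partial>M) + (\<integral>x. (g x)\<^sup>2 \<partial>M)"
    using L2_mult_integrable[OF assms] L2_integrable_square[OF assms(1)]
      L2_integrable_square[OF assms(2)] by simp
  finally show ?thesis unfolding L2norm_square .
qed

text \<open>Inserting \<open>w\<close> and writing s = u - w, t = w - v, this is (s + t)^2 \<le> 2
  s^2 + 2 t^2, that is 0 \<le> (s - t)^2, integrated. It trades the distance between two net points
  for their distances to the signal.\<close>

lemma L2norm_diff_square_le: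
  assumes "u \<in> L2 M" "v \<in> L2 M" "w \<in> L2 M"
  shows "(L2norm M (\<lambda>x. u x - v x))\<^sup>2
    \<le> 2 * (L2norm M (\<lambda>x. u x - w x))\<^sup>2 + 2 * (L2norm M (\<lambda>x. w x - v x))\<^sup>2"
proof -
  have i: "integrable M (\<lambda>x. (u x - v x)\<^sup>2)" "integrable M (\<lambda>x. (u x - w x)\<^sup>2)"
      "integrable M (\<lambda>x. (w x - v x)\<^sup>2)"
    using assms by (auto intro!: L2_integrable_square L2_diff)
  have le: "(a - b)\<^sup>2 \<le> 2 * (a - c)\<^sup>2 + 2 * (c - b)\<^sup>2" for a b c :: real
    using zero_le_power2[of "(a - c) - (c - b)"] by (simp add: power2_eq_square algebra_simps)
  have "(\<integral>x. (u x - v x)\<^sup>2 \<partial>M) \<le> (\<integral>x. 2 * (u x - w x)\<^sup>2 + 2 * (w x - v x)\<^sup>2 \<partial>M)"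
    using i by (intro integral_mono le) auto
  then show ?thesis unfolding L2norm_square using i by simp
qed

lemma L2norm_eq_0_AE:
  assumes "f \<in> L2 M" "L2norm M f = 0"
  shows "AE x in M. f x = 0"
  using assms L2norm_square[of M f] integral_nonneg_eq_0_iff_AE[OF L2_integrable_square[OF assms(1)]]
  by simp

text \<open>The value depends only on the pairwise products, so two triples with equal Gram matrices
  give the same value. In this way a linear relation between functions passes to their white noise
  integrals.\<close>

lemma integral_lincomb_square:
  fixes f g h :: "'a \<Rightarrow> real"
  assumes [simp]: "integrable M (\<lambda>x. f x * f x)" "integrable M (\<lambda>x. f x * g x)"
    "integrable M (\<lambda>x. f x * h x)" "integrable M (\<lambda>x. g x * g x)"
    "integrable M (\<lambda>x. g x * h x)" "integrable M (\<lambda>x. h x * h x)"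
  shows "integrable M (\<lambda>x. (f x - (a * g x + b * h x))\<^sup>2)"
    and "(\<integral>x. (f x - (a * g x + b * h x))\<^sup>2 \<partial>M) = (\<integral>x. f x * f x \<partial>M)
      - 2 * a * (\<integral>x. f x * g x \<partial>M) - 2 * b * (\<integral>x. f x * h x \<partial>M)
      + a\<^sup>2 * (\<integral>x. g x * g x \<partial>M) + 2 * a * b * (\<integral>x. g x * h x \<partial>M)
      + b\<^sup>2 * (\<integral>x. h x * h x \<partial>M)"
proof -
  have eq: "(\<lambda>x. (f x - (a * g x + b * h x))\<^sup>2) = (\<lambda>x. f x * f x - 2 * a * (f x * g x)
      - 2 * b * (f x * h x) + a\<^sup>2 * (g x * g x) + 2 * a * b * (g x * h x) + b\<^sup>2 * (h x * h x))"
    by (auto simp: power2_eq_square algebra_simps)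
  show "integrable M (\<lambda>x. (f x - (a * g x + b * h x))\<^sup>2)"
    unfolding eq by simp
  show "(\<integral>x. (f x - (a * g x + b * h x))\<^sup>2 \<partial>M) = (\<integral>x. f x * f x \<partial>M)
      - 2 * a * (\<integral>x. f x * g x \<partial>M) - 2 * b * (\<integral>x. f x * h x \<partial>M)
      + a\<^sup>2 * (\<integral>x. g x * g x \<partial>M) + 2 * a * b * (\<integral>x. g x * h x \<partial>M)
      + b\<^sup>2 * (\<integral>x. h x * h x \<partial>M)"
    unfolding eq by simp
qed

text \<open>The defect of linearity \<open>h\<close> is tested against itself: adjointness moves
  \<open>S\<close> off each argument, \<open>T h\<close> is then paired with \<open>g\<close> minus
  its own linear combination, which is 0, so \<open>h\<close> has norm 0.\<close>

lemma L2_adjoint_linear: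
  assumes adj: "L2_adjoint N M T S" and T: "L2_operator N M T"
    and g: "g1 \<in> L2 M" "g2 \<in> L2 M"
  shows "AE y in N. S (\<lambda>x. a * g1 x + b * g2 x) y = a * S g1 y + b * S g2 y"
proof -
  define g where "g = (\<lambda>x. a * g1 x + b * g2 x)"
  have gL: "g \<in> L2 M" unfolding g_def by (rule L2_lincomb[OF g])
  have SL: "S u \<in> L2 N" if "u \<in> L2 M" for u
    using adj that unfolding L2_adjoint_def L2_operator_def by blast
  define h where "h = (\<lambda>y. S g y - (a * S g1 y + b * S g2 y))"
  have hL: "h \<in> L2 N"
    unfolding h_def by (intro L2_diff SL gL L2_lincomb g)
  have ThL: "T h \<in> L2 M" using T hL unfolding L2_operator_def by blast
  have ip: "(\<integral>y. h y * S u y \<partial>N) = (\<integral>x. T h x * u x \<partial>M)" if "u \<in> L2 M" for u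
    using adj that hL unfolding L2_adjoint_def by simp
  have "(\<integral>y. (h y)\<^sup>2 \<partial>N) = (\<integral>y. h y * S g y - (a * (h y * S g1 y) + b * (h y * S g2 y)) \<partial>N)"
    by (rule arg_cong[where f = "integral\<^sup>L N"])
      (auto simp: h_def power2_eq_square algebra_simps)
  also have "\<dots> = (\<integral>y. h y * S g y \<partial>N)
      - (a * (\<integral>y. h y * S g1 y \<partial>N) + b * (\<integral>y. h y * S g2 y \<partial>N))"
    using L2_mult_integrable[OF hL SL[OF gL]] L2_mult_integrable[OF hL SL[OF g(1)]]
      L2_mult_integrable[OF hL SL[OF g(2)]] by simp
  also have "\<dots> = (\<integral>x. T h x * g x \<partial>M) - (\<integral>x. a * (T h x * g1 x) + b * (T h x * g2 x) \<partial>M)"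
    using L2_mult_integrable[OF ThL g(1)] L2_mult_integrable[OF ThL g(2)]
    by (simp add: ip gL g)
  also have "\<dots> = 0"
    by (simp add: g_def algebra_simps)
  finally have "L2norm N h = 0" by (simp add: L2norm_def)
  from L2norm_eq_0_AE[OF hL this] show ?thesis
    by (simp add: h_def g_def)
qed

section \<open>White noise\<close>

text \<open>This puts white noise integrals into \<open>L2 M\<close>, which makes their products
  integrable. With a density, the moments about the mean \<open>m\<close> are known and the square
  is expanded around \<open>m\<close>.\<close>

lemma (in prob_space) gaussian_rv_integrable_square:
  assumes "gaussian_rv M X"
  shows "integrable M (\<lambda>\<omega>. (X \<omega>)\<^sup>2)"
proof -
  have [measurable]: "X \<in> borel_measurable M" using assms by (simp add: gaussian_rv_def)
  consider m where "AE \<omega> in M. X \<omega> = m"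
    | m \<sigma> where "\<sigma> > 0" "distributed M lborel X (\<lambda>x. ennreal (normal_density m \<sigma> x))"
    using assms unfolding gaussian_rv_def by blast
  then show ?thesis
  proof cases
    case 1
    show ?thesis
      by (rule integrable_cong_AE_imp[where g = "\<lambda>_. m\<^sup>2"]) (use 1 in auto)
  next
    case 2
    have "integrable M (\<lambda>\<omega>. (X \<omega> - m)\<^sup>2)"
      using distributed_integrable[OF 2(2), of "\<lambda>x. (x - m)\<^sup>2"]
        integrable_normal_moment[OF 2(1), of m 2] by simp
    moreover have "integrable M (\<lambda>\<omega>. X \<omega> - m)"
      using distributed_integrable[OF 2(2), of "\<lambda>x. x - m"]
        integrable_normal_moment[OF 2(1), of m 1] by simp
    ultimately have "integrable M (\<lambda>\<omega>. (X \<omega> - m)\<^sup>2 + 2 * m * (X \<omega> - m) + m\<^sup>2)"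
      by simp
    moreover have "(\<lambda>\<omega>. (X \<omega> - m)\<^sup>2 + 2 * m * (X \<omega> - m) + m\<^sup>2) = (\<lambda>\<omega>. (X \<omega>)\<^sup>2)"
      by (auto simp: power2_eq_square algebra_simps)
    ultimately show ?thesis by simp
  qed
qed

text \<open>
  For \<open>X\<close> centred with variance \<open>s\<^sup>2\<close>, the factor \<open>exp (x\<^sup>2 / (4 s\<^sup>2))\<close> turns the normal density
  into \<open>sqrt 2\<close> times the normal density with variance \<open>2 s\<^sup>2\<close>.
\<close>

lemma (in prob_space) gaussian_rv_exp_square:
  assumes X: "gaussian_rv M X" and mean: "expectation X = 0"
    and var: "variance X = s\<^sup>2" and s: "s > 0"
  shows "integrable M (\<lambda>\<omega>. exp ((X \<omega> / s)\<^sup>2 / 4))"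
    and "expectation (\<lambda>\<omega>. exp ((X \<omega> / s)\<^sup>2 / 4)) = sqrt 2"
proof -
  have [measurable]: "X \<in> borel_measurable M" using X by (simp add: gaussian_rv_def)
  have var': "expectation (\<lambda>\<omega>. (X \<omega>)\<^sup>2) = s\<^sup>2" using var mean by simp
  \<comment> \<open>Mean 0 would force the constant to be 0, against the variance
    \<open>s\<^sup>2 > 0\<close>; only the case of a normal density is left.\<close>
  have not_const: False if "AE \<omega> in M. X \<omega> = m" for m
  proof -
    have "expectation X = expectation (\<lambda>_. m)"
      by (rule integral_cong_AE) (use that in auto)
    then have "m = 0" using mean by (simp add: prob_space)
    have "expectation (\<lambda>\<omega>. (X \<omega>)\<^sup>2) = expectation (\<lambda>_. 0)"
      by (rule integral_cong_AE) (use that \<open>m = 0\<close> in auto)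
    then show False using var' s by simp
  qed
  then obtain m \<sigma> where \<sigma>: "\<sigma> > 0"
    and D: "distributed M lborel X (\<lambda>x. ennreal (normal_density m \<sigma> x))"
    using X unfolding gaussian_rv_def by blast
  have "expectation X = m"
    using distributed_integral[OF D, of "\<lambda>x. x"] integral_normal_moment_nz_1[OF \<sigma>, of m] by simp
  then have m: "m = 0" using mean by simp
  have "expectation (\<lambda>\<omega>. (X \<omega>)\<^sup>2) = \<sigma>\<^sup>2"
    using distributed_integral[OF D, of "\<lambda>x. x\<^sup>2"] integral_normal_moment_even[OF \<sigma>, of m 1] m
    by (simp add: fact_numeral)
  then have "\<sigma>\<^sup>2 = s\<^sup>2" using var' by simp
  then have \<sigma>s: "\<sigma> = s" using \<sigma> s by simp
  have eq: "normal_density m \<sigma> x * exp ((x / s)\<^sup>2 / 4) = sqrt 2 * normal_density 0 (sqrt 2 * s) x"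
    for x
  proof -
    have "normal_density m \<sigma> x * exp ((x / s)\<^sup>2 / 4)
        = 1 / sqrt (2 * pi * s\<^sup>2) * exp (- x\<^sup>2 / (2 * s\<^sup>2) + (x / s)\<^sup>2 / 4)"
      unfolding normal_density_def m \<sigma>s by (simp only: exp_add) simp
    \<comment> \<open>In units of x^2 / s^2 the exponents add up to - 1/2 + 1/4 = - 1/4, which
      belongs to the variance 2 s^2.\<close>
    also have "- x\<^sup>2 / (2 * s\<^sup>2) + (x / s)\<^sup>2 / 4 = - x\<^sup>2 / (2 * (sqrt 2 * s)\<^sup>2)"
      using s by (simp add: field_simps)
    finally have *: "normal_density m \<sigma> x * exp ((x / s)\<^sup>2 / 4)
        = 1 / sqrt (2 * pi * s\<^sup>2) * exp (- x\<^sup>2 / (2 * (sqrt 2 * s)\<^sup>2))" .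
    have sqrt_eq: "sqrt (2 * pi * (sqrt 2 * s)\<^sup>2) = sqrt 2 * sqrt (2 * pi * s\<^sup>2)"
      by (subst real_sqrt_mult[symmetric]) (simp add: power_mult_distrib mult_ac)
    show ?thesis
      unfolding * unfolding normal_density_def sqrt_eq diff_0_right by simp
  qed
  have s2: "sqrt 2 * s > 0" using s by simp
  show "integrable M (\<lambda>\<omega>. exp ((X \<omega> / s)\<^sup>2 / 4))"
    using distributed_integrable[OF D, of "\<lambda>x. exp ((x / s)\<^sup>2 / 4)"]
      integrable_normal_density[OF s2, of 0] by (simp add: eq)
  show "expectation (\<lambda>\<omega>. exp ((X \<omega> / s)\<^sup>2 / 4)) = sqrt 2"
    using distributed_integral[OF D, of "\<lambda>x. exp ((x / s)\<^sup>2 / 4)"]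
      integral_normal_density[OF s2, of 0] by (simp add: eq)
qed

context prob_space
begin

lemma white_noise_gaussian:
  assumes "white_noise M N W" "h \<in> L2 N"
  shows "gaussian_rv M (W h)"
proof -
  have "gaussian_vector2 M (W h) (W h)" using assms unfolding white_noise_def by blast
  then have "gaussian_rv M (\<lambda>\<omega>. 1 * W h \<omega> + 0 * W h \<omega>)" unfolding gaussian_vector2_def by blast
  then show ?thesis by simp
qed

lemma white_noise_L2:
  assumes "white_noise M N W" "h \<in> L2 N"
  shows "W h \<in> L2 M"
  using gaussian_rv_integrable_square[OF white_noise_gaussian[OF assms]]
    white_noise_gaussian[OF assms] by (simp add: L2_def gaussian_rv_def)

text \<open>The Gram matrix of \<open>h\<close>, \<open>h1\<close>, \<open>h2\<close> is preserved by \<open>W\<close>, hence so are their linear relations.\<close>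

lemma white_noise_linear:
  assumes noise: "white_noise M N W"
    and h: "h \<in> L2 N" "h1 \<in> L2 N" "h2 \<in> L2 N"
    and eq: "AE y in N. h y = a * h1 y + b * h2 y"
  shows "AE \<omega> in M. W h \<omega> = a * W h1 \<omega> + b * W h2 \<omega>"
proof -
  have ip: "(\<integral>\<omega>. W u \<omega> * W v \<omega> \<partial>M) = (\<integral>y. u y * v y \<partial>N)" if "u \<in> L2 N" "v \<in> L2 N" for u v
    using noise that unfolding white_noise_def by blast
  note [intro] = L2_mult_integrable white_noise_L2[OF noise] h
  have "(\<integral>\<omega>. (W h \<omega> - (a * W h1 \<omega> + b * W h2 \<omega>))\<^sup>2 \<partial>M)
      = (\<integral>y. (h y - (a * h1 y + b * h2 y))\<^sup>2 \<partial>N)"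
    by (subst (1 2) integral_lincomb_square(2)) (auto simp: ip h)
  also have "\<dots> = (\<integral>y. 0 \<partial>N)"
  proof (rule integral_cong_AE)
    show "(\<lambda>y. (h y - (a * h1 y + b * h2 y))\<^sup>2) \<in> borel_measurable N"
      by (intro borel_measurable_integrable L2_integrable_square L2_diff L2_lincomb h)
  qed (use eq in auto)
  finally have "(\<integral>\<omega>. (W h \<omega> - (a * W h1 \<omega> + b * W h2 \<omega>))\<^sup>2 \<partial>M) = 0" by simp
  moreover have "integrable M (\<lambda>\<omega>. (W h \<omega> - (a * W h1 \<omega> + b * W h2 \<omega>))\<^sup>2)"
    by (rule integral_lincomb_square(1)) auto
  ultimately show ?thesis
    by (subst (asm) integral_nonneg_eq_0_iff_AE) auto
qed

text \<open>For \<open>L2norm N h = 0\<close> the quotient below is \<open>0\<close>, and \<open>W h\<close> vanishes almost surely.\<close>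

lemma white_noise_normalized:
  assumes noise: "white_noise M N W" and h: "h \<in> L2 N"
  defines "\<xi> \<equiv> \<lambda>\<omega>. W h \<omega> / L2norm N h"
  shows "integrable M (\<lambda>\<omega>. exp ((\<xi> \<omega>)\<^sup>2 / 4))"
    and "expectation (\<lambda>\<omega>. exp ((\<xi> \<omega>)\<^sup>2 / 4)) \<le> 2"
    and "AE \<omega> in M. W h \<omega> = L2norm N h * \<xi> \<omega>"
proof -
  have mean: "expectation (W h) = 0" and var: "variance (W h) = (L2norm N h)\<^sup>2"
    using noise h unfolding white_noise_def by blast+
  have "integrable M (\<lambda>\<omega>. exp ((\<xi> \<omega>)\<^sup>2 / 4)) \<and> expectation (\<lambda>\<omega>. exp ((\<xi> \<omega>)\<^sup>2 / 4)) \<le> 2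
    \<and> (AE \<omega> in M. W h \<omega> = L2norm N h * \<xi> \<omega>)"
  proof (cases "L2norm N h = 0")
    case True
    \<comment> \<open>The zero function is written as a trivial combination, so that linearity
      yields \<open>W h = 0\<close> almost surely.\<close>
    have "AE y in N. h y = 0 * h y + 0 * h y"
      using L2norm_eq_0_AE[OF h True] by simp
    from white_noise_linear[OF noise h h h this] show ?thesis
      using True by (simp add: \<xi>_def prob_space)
  next
    case False
    then have s: "L2norm N h > 0" by (simp add: order_less_le)
    \<comment> \<open>The bound 2 covers both this case and the degenerate one, where the
      expectation is 1.\<close>
    have "sqrt 2 \<le> (2::real)" by (rule real_le_lsqrt) auto
    with gaussian_rv_exp_square[OF white_noise_gaussian[OF noise h] mean var s] False
    show ?thesis unfolding \<xi>_def by simp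
  qed
  then show "integrable M (\<lambda>\<omega>. exp ((\<xi> \<omega>)\<^sup>2 / 4))"
    and "expectation (\<lambda>\<omega>. exp ((\<xi> \<omega>)\<^sup>2 / 4)) \<le> 2"
    and "AE \<omega> in M. W h \<omega> = L2norm N h * \<xi> \<omega>" by auto
qed

end

section \<open>Noise of sums and the empirical risk\<close>

lemma L2_operator_in: "L2_operator M N T \<Longrightarrow> f \<in> L2 M \<Longrightarrow> T f \<in> L2 N"
  unfolding L2_operator_def by blast

lemma L2_adjoint_operator: "L2_adjoint N M T S \<Longrightarrow> L2_operator M N S"
  unfolding L2_adjoint_def by blast

text \<open>A function of norm 0 agrees almost everywhere with a zero combination, which
  \<open>S\<close> sends to 0 by linearity. This settles pairs at distance 0, whose quotient in
  \<open>varrho\<close> is 0 only because division by 0 gives 0.\<close>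

lemma L2_adjoint_norm_0:
  assumes adj: "L2_adjoint N M T S" and T: "L2_operator N M T"
    and g: "g \<in> L2 M" "L2norm M g = 0"
  shows "L2norm N (S g) = 0"
proof -
  note S = L2_adjoint_operator[OF adj]
  define z where "z = (\<lambda>x. 0 * g x + 0 * g x)"
  have z: "z \<in> L2 M" unfolding z_def by (intro L2_lincomb g)
  have "AE x in M. g x = z x"
    using L2norm_eq_0_AE[OF g] by (simp add: z_def)
  then have "AE y in N. S g y = S z y"
    using S g(1) z unfolding L2_operator_def by blast
  moreover have "AE y in N. S z y = 0"
    using L2_adjoint_linear[OF adj T g(1) g(1), of 0 0] by (simp add: z_def)
  ultimately have "AE y in N. S g y = 0" by eventually_elim simp
  then have "(\<integral>y. (S g y)\<^sup>2 \<partial>N) = 0"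
    by (intro integral_eq_zero_AE) auto
  then show ?thesis by (simp add: L2norm_def)
qed

context
  fixes N :: "'b measure" and M :: "'a measure"
    and S :: "('a \<Rightarrow> real) \<Rightarrow> 'b \<Rightarrow> real" and H :: "('a \<Rightarrow> real) set"
  assumes H: "finite H" "card H \<ge> 2"
begin

lemma varrho_ge:
  assumes "\<phi> \<in> H" "\<psi> \<in> H" "\<phi> \<noteq> \<psi>"
  shows "L2norm N (S (\<lambda>x. \<phi> x - \<psi> x)) / L2norm M (\<lambda>x. \<phi> x - \<psi> x) \<le> varrho M N S H"
proof -
  let ?q = "\<lambda>(\<phi>, \<psi>). L2norm N (S (\<lambda>x. \<phi> x - \<psi> x)) / L2norm M (\<lambda>x. \<phi> x - \<psi> x)"
  have "{L2norm N (S (\<lambda>x. \<phi> x - \<psi> x)) / L2norm M (\<lambda>x. \<phi> x - \<psi> x) | \<phi> \<psi>.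
      \<phi> \<in> H \<and> \<psi> \<in> H \<and> \<phi> \<noteq> \<psi>} \<subseteq> ?q ` (H \<times> H)"
    by auto
  then have "finite {L2norm N (S (\<lambda>x. \<phi> x - \<psi> x)) / L2norm M (\<lambda>x. \<phi> x - \<psi> x) | \<phi> \<psi>.
      \<phi> \<in> H \<and> \<psi> \<in> H \<and> \<phi> \<noteq> \<psi>}"
    using H(1) by (meson finite_SigmaI finite_imageI finite_subset)
  then show ?thesis
    unfolding varrho_def by (rule Max_ge) (use assms in blast)
qed

text \<open>Two distinct elements make the set under \<open>Max\<close> nonempty, and any one of its
  quotients is a nonnegative lower bound of the maximum.\<close>

lemma varrho_nonneg: "0 \<le> varrho M N S H"
proof -
  obtain \<phi> \<psi> where "\<phi> \<in> H" "\<psi> \<in> H" "\<phi> \<noteq> \<psi>"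
    using H by (metis card_le_Suc0_iff_eq not_less_eq_eq numeral_2_eq_2)
  from varrho_ge[OF this] show ?thesis
    by (rule order_trans[rotated]) simp
qed

lemma L2norm_adjoint_le_varrho:
  assumes adj: "L2_adjoint N M T S" and T: "L2_operator N M T"
    and HL: "H \<subseteq> L2 M" and \<phi>\<psi>: "\<phi> \<in> H" "\<psi> \<in> H"
  shows "L2norm N (S (\<lambda>x. \<phi> x - \<psi> x)) \<le> varrho M N S H * L2norm M (\<lambda>x. \<phi> x - \<psi> x)"
proof (cases "L2norm M (\<lambda>x. \<phi> x - \<psi> x) = 0")
  case True
  then show ?thesis
    using L2_adjoint_norm_0[OF adj T _ True] HL \<phi>\<psi> by (simp add: L2_diff subset_iff)
next
  case False
  then have "\<phi> \<noteq> \<psi>" by (auto simp: L2norm_def)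
  from varrho_ge[OF \<phi>\<psi> this] False show ?thesis
    by (simp add: divide_le_eq order_less_le)
qed

end

context prob_space
begin

text \<open>Almost everywhere linearity of \<open>Q\<close> combines with almost sure linearity of
  \<open>W\<close>. The exceptional null set depends on the coefficients and functions, so later use
  is confined to finitely many of them.\<close>

lemma white_noise_adjoint_linear:
  assumes noise: "white_noise M N W" and adj: "L2_adjoint N L T Q" and T: "L2_operator N L T"
    and g: "g1 \<in> L2 L" "g2 \<in> L2 L"
  shows "AE \<omega> in M. W (Q (\<lambda>x. a * g1 x + b * g2 x)) \<omega> = a * W (Q g1) \<omega> + b * W (Q g2) \<omega>"
  by (rule white_noise_linear[OF noise])
    (intro L2_operator_in[OF L2_adjoint_operator[OF adj]] L2_lincomb g
      L2_adjoint_linear[OF adj T])+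

lemma white_noise_adjoint_diff:
  assumes noise: "white_noise M N W" and adj: "L2_adjoint N L T Q" and T: "L2_operator N L T"
    and g: "g1 \<in> L2 L" "g2 \<in> L2 L"
  shows "AE \<omega> in M. W (Q (\<lambda>x. g1 x - g2 x)) \<omega> = W (Q g1) \<omega> - W (Q g2) \<omega>"
  using white_noise_adjoint_linear[OF assms, of 1 "-1"] by simp

lemma white_noise_adjoint_sum:
  assumes noise: "white_noise M N W" and adj: "L2_adjoint N L T Q" and T: "L2_operator N L T"
    and J: "finite J" and g: "\<And>j. j \<in> J \<Longrightarrow> g j \<in> L2 L"
  shows "AE \<omega> in M. W (Q (\<lambda>x. \<Sum>j\<in>J. g j x)) \<omega> = (\<Sum>j\<in>J. W (Q (g j)) \<omega>)"
  using J g
proof (induction J)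
  case empty
  have "(\<lambda>_. 0) \<in> L2 L" by (simp add: L2_def)
  from white_noise_adjoint_linear[OF noise adj T this this, of 0 0] show ?case by simp
next
  case (insert j J)
  then have "AE \<omega> in M. W (Q (\<lambda>x. \<Sum>j\<in>J. g j x)) \<omega> = (\<Sum>j\<in>J. W (Q (g j)) \<omega>)" by simp
  moreover have "AE \<omega> in M. W (Q (\<lambda>x. 1 * g j x + 1 * (\<Sum>j\<in>J. g j x))) \<omega>
      = 1 * W (Q (g j)) \<omega> + 1 * W (Q (\<lambda>x. \<Sum>j\<in>J. g j x)) \<omega>"
    using insert.prems by (intro white_noise_adjoint_linear[OF noise adj T] L2_sum) auto
  ultimately show ?case
    by eventually_elim (simp add: insert.hyps)
qed

end

text \<open>Since \<open>Q\<close> is the adjoint of the inverse of \<open>A\<close>, pairing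
  \<open>Q g\<close> with \<open>A f\<close> is the same as pairing \<open>g\<close> with
  \<open>f\<close>; completing the square gives the distance to \<open>f\<close>.\<close>

lemma empirical_risk_eq:
  assumes A: "L2_operator M N A" and inv: "L2_inverse M N A B" and adj: "L2_adjoint N M B Q"
    and fg: "f \<in> L2 M" "g \<in> L2 M"
  shows "empirical_risk M Q (obs_integral N W n (A f)) g \<omega>
    = (L2norm M (\<lambda>x. g x - f x))\<^sup>2 - (L2norm M f)\<^sup>2 - 2 * real n powr (- 1 / 2) * W (Q g) \<omega>"
proof -
  have Af: "A f \<in> L2 N" by (rule L2_operator_in[OF A fg(1)])
  have BAf: "B (A f) \<in> L2 M"
    using inv L2_operator_in[OF _ Af] unfolding L2_inverse_def by metis
  have "(\<integral>y. Q g y * A f y \<partial>N) = (\<integral>y. A f y * Q g y \<partial>N)"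
    by (simp add: mult.commute)
  also have "\<dots> = (\<integral>x. B (A f) x * g x \<partial>M)"
    using adj Af fg(2) unfolding L2_adjoint_def by simp
  also have "\<dots> = (\<integral>x. g x * f x \<partial>M)"
  proof (rule integral_cong_AE)
    show "AE x in M. B (A f) x * g x = g x * f x"
      using inv fg(1) unfolding L2_inverse_def by auto
  qed (intro borel_measurable_integrable L2_mult_integrable BAf fg)+
  finally show ?thesis
    unfolding empirical_risk_def obs_integral_def L2norm_diff_square[OF fg(2,1)]
    by (simp add: algebra_simps)
qed

text \<open>The weight c/4 is chosen for the absorption: summed over the components, the first terms
  come to at most a quarter of the squared norm of the whole difference.\<close>

lemma young_quarter:
  fixes c u v :: real
  assumes "c > 0"
  shows "2 * (u * v) \<le> c / 4 * u\<^sup>2 + 4 / c * v\<^sup>2"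
proof -
  have "0 \<le> (c * u - 4 * v)\<^sup>2 / (4 * c)" using assms by simp
  also have "\<dots> = c / 4 * u\<^sup>2 - 2 * (u * v) + 4 / c * v\<^sup>2"
    using assms by (simp add: power2_eq_square field_simps)
  finally show ?thesis by simp
qed

text \<open>The tangent line of \<open>exp\<close> at \<open>l\<close> replaces Jensen's inequality in bounding the expected maximum.\<close>

lemma square_le_exp_sum:
  fixes \<xi> :: "'i \<Rightarrow> real"
  assumes "finite H" "i \<in> H"
  shows "(\<xi> i)\<^sup>2 \<le> 4 * (l - 1 + (\<Sum>k\<in>H. exp ((\<xi> k)\<^sup>2 / 4)) / exp l)"
proof -
  have "1 + ((\<xi> i)\<^sup>2 / 4 - l) \<le> exp ((\<xi> i)\<^sup>2 / 4) / exp l"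
    using exp_ge_add_one_self[of "(\<xi> i)\<^sup>2 / 4 - l"] by (simp add: exp_diff)
  also have "\<dots> \<le> (\<Sum>k\<in>H. exp ((\<xi> k)\<^sup>2 / 4)) / exp l"
    using assms by (intro divide_right_mono member_le_sum) auto
  finally show ?thesis by simp
qed

theorem theorem5:
  fixes \<nu> :: "'y::topological_space measure"
    and Y :: "'y set"
    and A :: "((real ^ 'd) \<Rightarrow> real) \<Rightarrow> ('y \<Rightarrow> real)"
    and A_inv :: "('y \<Rightarrow> real) \<Rightarrow> ((real ^ 'd) \<Rightarrow> real)"
    and Q :: "((real ^ 'd) \<Rightarrow> real) \<Rightarrow> ('y \<Rightarrow> real)"
    and M :: "'w measure"
    and W :: "('y \<Rightarrow> real) \<Rightarrow> 'w \<Rightarrow> real"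
    and n p :: nat
    and F :: "((real ^ 'd) \<Rightarrow> real) set"
    and Fs :: "nat \<Rightarrow> ((real ^ 'd) \<Rightarrow> real) set"
    and F\<delta> :: "((real ^ 'd) \<Rightarrow> real) set"
    and Fs\<delta> :: "nat \<Rightarrow> ((real ^ 'd) \<Rightarrow> real) set"
    and \<delta> c :: real
    and lam \<rho> :: "nat \<Rightarrow> real"
    and f :: "(real ^ 'd) \<Rightarrow> real"
    and fhat :: "'w \<Rightarrow> (real ^ 'd) \<Rightarrow> real"
  assumes borel_space: "sets \<nu> = sets (restrict_space borel Y)"
    and A: "L2_linear_operator lebesgue \<nu> A"
    and A_inv: "L2_inverse lebesgue \<nu> A A_inv"
    and Q: "L2_adjoint \<nu> lebesgue A_inv Q"
    and prob: "prob_space M"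
    and noise: "white_noise M \<nu> W"
    and n: "n \<ge> 1"
    and p: "p \<ge> 1"
    and Fs_L2: "\<And>j. j \<in> {1..p} \<Longrightarrow> Fs j \<subseteq> L2 lebesgue"
    and F_sub: "F \<subseteq> direct_sum p Fs"
    and F\<delta>_finite: "finite F\<delta>"
    and F\<delta>_net: "delta_net lebesgue \<delta> F F\<delta>"
    and F\<delta>_sub: "F\<delta> \<subseteq> direct_sum p Fs\<delta>"
    and Fs\<delta>_finite: "\<And>j. j \<in> {1..p} \<Longrightarrow> finite (Fs\<delta> j)"
    and Fs\<delta>_sub: "\<And>j. j \<in> {1..p} \<Longrightarrow> Fs\<delta> j \<subseteq> Fs j"
    and Fs\<delta>_two: "\<And>j. j \<in> {1..p} \<Longrightarrow> card (Fs\<delta> j) \<ge> 2"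
    and lam: "\<And>j. j \<in> {1..p} \<Longrightarrow> real (card (Fs\<delta> j)) = exp (lam j)"
    and rho: "\<And>j. j \<in> {1..p} \<Longrightarrow> \<rho> j = varrho lebesgue \<nu> Q (Fs\<delta> j)"
    and c_pos: "c > 0"
    and c_bound: "\<And>g. (\<forall>j\<in>{1..p}. \<exists>u\<in>Fs j. \<exists>v\<in>Fs j. g j = (\<lambda>x. u x - v x)) \<Longrightarrow>
        (L2norm lebesgue (\<lambda>x. \<Sum>j=1..p. g j x))\<^sup>2 \<ge> c * (\<Sum>j=1..p. (L2norm lebesgue (g j))\<^sup>2)"
    and f: "f \<in> F"
    and fhat_rv: "fhat \<in> measurable M (count_space F\<delta>)"
    and fhat_min: "\<And>\<omega> \<phi>. \<omega> \<in> space M \<Longrightarrow> \<phi> \<in> F\<delta> \<Longrightarrow>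
        empirical_risk lebesgue Q (obs_integral \<nu> W n (A f)) (fhat \<omega>) \<omega>
          \<le> empirical_risk lebesgue Q (obs_integral \<nu> W n (A f)) \<phi> \<omega>"
  shows "(\<integral>\<omega>. (L2norm lebesgue (\<lambda>x. fhat \<omega> x - f x))\<^sup>2 \<partial>M)
     \<le> 3 * \<delta>\<^sup>2 + 32 * inverse c * inverse (real n) *
         ((\<Sum>j=1..p. (\<rho> j)\<^sup>2 * lam j) + (\<Sum>j=1..p. \<rho> j)\<^sup>2)"
proof -
  interpret prob_space M by (rule prob)

  \<comment> \<open>Decompositions of the net points and a net point near the signal\<close>
  let ?J = "{1..p}"
  define r where "r = real n powr (- 1 / 2)"
  have r: "r \<ge> 0" "r\<^sup>2 = inverse (real n)"
    using n by (simp_all add: r_def powr_minus powr_half_sqrt power_inverse)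
  have T: "L2_operator \<nu> lebesgue A_inv" using A_inv unfolding L2_inverse_def by blast
  have A': "L2_operator lebesgue \<nu> A" using A unfolding L2_linear_operator_def by blast
  note QL = L2_operator_in[OF L2_adjoint_operator[OF Q]]
  have Fs\<delta>_L2: "g \<in> L2 lebesgue" if "j \<in> ?J" "g \<in> Fs\<delta> j" for j g
    using that Fs_L2 Fs\<delta>_sub by blast
  \<comment> \<open>One decomposition is chosen for each net point; applied to
    \<open>fhat \<omega>\<close> it yields the components of the minimizer.\<close>
  have "\<forall>\<phi>\<in>F\<delta>. \<exists>g. \<phi> = (\<lambda>x. \<Sum>j=1..p. g j x) \<and> (\<forall>j\<in>?J. g j \<in> Fs\<delta> j)"
    using F\<delta>_sub unfolding direct_sum_def by blast
  then obtain dec where dec: "\<And>\<phi>. \<phi> \<in> F\<delta> \<Longrightarrow> \<phi> = (\<lambda>x. \<Sum>j=1..p. dec \<phi> j x)"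
      "\<And>\<phi> j. \<phi> \<in> F\<delta> \<Longrightarrow> j \<in> ?J \<Longrightarrow> dec \<phi> j \<in> Fs\<delta> j"
    by metis
  have dec_L2: "dec \<phi> j \<in> L2 lebesgue" if "\<phi> \<in> F\<delta>" "j \<in> ?J" for \<phi> j
    using dec(2) that Fs\<delta>_L2 by blast
  have F\<delta>_L2: "\<phi> \<in> L2 lebesgue" if "\<phi> \<in> F\<delta>" for \<phi>
    by (subst dec(1)[OF that]) (intro L2_sum dec_L2 that)
  have f_L2: "f \<in> L2 lebesgue"
  proof -
    obtain g where g: "f = (\<lambda>x. \<Sum>j=1..p. g j x)" "\<forall>j\<in>?J. g j \<in> Fs j"
      using f F_sub unfolding direct_sum_def by blast
    have "g j \<in> L2 lebesgue" if "j \<in> ?J" for j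
      using Fs_L2[OF that] g(2) that by blast
    then show ?thesis unfolding g(1) by (rule L2_sum)
  qed
  obtain \<eta> where \<eta>: "\<eta> \<in> F\<delta>" and \<eta>_near: "L2norm lebesgue (\<lambda>x. f x - \<eta> x) \<le> \<delta>"
    using F\<delta>_net f unfolding delta_net_def by blast
  have \<eta>_near2: "(L2norm lebesgue (\<lambda>x. f x - \<eta> x))\<^sup>2 \<le> \<delta>\<^sup>2"
    using \<eta>_near by (simp add: power_mono)
  have swap: "L2norm lebesgue (\<lambda>x. \<eta> x - f x) = L2norm lebesgue (\<lambda>x. f x - \<eta> x)"
    by (simp add: L2norm_def power2_commute)

  \<comment> \<open>Normalized Gaussian families and their maxima\<close>
  define D where "D j \<psi> = (\<lambda>x. \<psi> x - dec \<eta> j x)" for j \<psi>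
  \<comment> \<open>All differences start from the fixed components of \<eta>, so component j needs
    one variable for each element of \<open>Fs\<delta> j\<close> and not one for each pair.\<close>
  define \<xi> where "\<xi> j \<psi> \<omega> = W (Q (D j \<psi>)) \<omega> / L2norm \<nu> (Q (D j \<psi>))" for j \<psi> \<omega>
  \<comment> \<open>\<open>G j\<close> is an integrable majorant of all
    \<open>(\<xi> j \<psi> \<omega>)\<^sup>2\<close>. The tangent point \<open>lam j\<close> makes
    the expected sum of at most 2 exp(lambda_j) cancel against \<open>exp (lam j)\<close>.\<close>
  define G where "G j \<omega> = 4 * (lam j - 1 + (\<Sum>\<psi>\<in>Fs\<delta> j. exp ((\<xi> j \<psi> \<omega>)\<^sup>2 / 4)) / exp (lam j))"
    for j \<omega>
  have D_L2: "D j \<psi> \<in> L2 lebesgue" if "j \<in> ?J" "\<psi> \<in> Fs\<delta> j" for j \<psi>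
    unfolding D_def using that \<eta> by (intro L2_diff Fs\<delta>_L2 dec_L2) auto
  have \<xi>: "integrable M (\<lambda>\<omega>. exp ((\<xi> j \<psi> \<omega>)\<^sup>2 / 4))"
      "expectation (\<lambda>\<omega>. exp ((\<xi> j \<psi> \<omega>)\<^sup>2 / 4)) \<le> 2"
      "AE \<omega> in M. W (Q (D j \<psi>)) \<omega> = L2norm \<nu> (Q (D j \<psi>)) * \<xi> j \<psi> \<omega>"
    if "j \<in> ?J" "\<psi> \<in> Fs\<delta> j" for j \<psi>
    using white_noise_normalized[OF noise QL[OF D_L2[OF that]]] unfolding \<xi>_def by auto
  have \<rho>_nonneg: "0 \<le> \<rho> j" if "j \<in> ?J" for j
    unfolding rho[OF that] using that by (intro varrho_nonneg Fs\<delta>_finite Fs\<delta>_two)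
  have \<rho>_bound: "L2norm \<nu> (Q (D j \<psi>)) \<le> \<rho> j * L2norm lebesgue (D j \<psi>)"
    if "j \<in> ?J" "\<psi> \<in> Fs\<delta> j" for j \<psi>
    unfolding rho[OF that(1)] D_def
    using that dec(2)[OF \<eta>] Fs\<delta>_L2
    by (intro L2norm_adjoint_le_varrho[OF _ _ Q T] Fs\<delta>_finite Fs\<delta>_two) auto
  have \<xi>_le_G: "(\<xi> j \<psi> \<omega>)\<^sup>2 \<le> G j \<omega>" if "j \<in> ?J" "\<psi> \<in> Fs\<delta> j" for j \<psi> \<omega>
    unfolding G_def by (rule square_le_exp_sum[OF Fs\<delta>_finite[OF that(1)] that(2)])
  have G_nonneg: "0 \<le> G j \<omega>" if "j \<in> ?J" for j \<omega>
    using \<xi>_le_G[OF that dec(2)[OF \<eta> that], of \<omega>] by (rule order_trans[rotated]) simp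
  have G_integrable: "integrable M (G j)" if "j \<in> ?J" for j
    unfolding G_def using \<xi>(1)[OF that]
    by (intro integrable_mult_right Bochner_Integration.integrable_add integrable_divide
        Bochner_Integration.integrable_sum) auto
  have G_mean: "expectation (G j) \<le> 4 * (lam j + 1)" if "j \<in> ?J" for j
  proof -
    have "expectation (G j) = 4 * (lam j - 1
        + (\<Sum>\<psi>\<in>Fs\<delta> j. expectation (\<lambda>\<omega>. exp ((\<xi> j \<psi> \<omega>)\<^sup>2 / 4))) / exp (lam j))"
      unfolding G_def using \<xi>(1)[OF that]
      by (simp add: prob_space Bochner_Integration.integral_add Bochner_Integration.integral_sum)
    also have "\<dots> \<le> 4 * (lam j - 1 + (\<Sum>\<psi>\<in>Fs\<delta> j. 2) / exp (lam j))"
      using \<xi>(2)[OF that] by (intro mult_left_mono add_left_mono divide_right_mono sum_mono) auto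
    also have "(\<Sum>\<psi>\<in>Fs\<delta> j. 2) / exp (lam j) = (2 :: real)"
      using lam[OF that] by simp
    finally show ?thesis by simp
  qed

  have D_sum: "(\<lambda>x. \<phi> x - \<eta> x) = (\<lambda>x. \<Sum>j\<in>?J. D j (dec \<phi> j) x)" if "\<phi> \<in> F\<delta>" for \<phi>
    by (subst dec(1)[OF that], subst dec(1)[OF \<eta>]) (simp add: D_def sum_subtractf)
  \<comment> \<open>The nets are finite, so one null set serves for all indices at once; only then
    may the random index coming from \<open>fhat \<omega>\<close> be inserted.\<close>
  have AE_\<xi>: "AE \<omega> in M. \<forall>j\<in>?J. \<forall>\<psi>\<in>Fs\<delta> j.
      W (Q (D j \<psi>)) \<omega> = L2norm \<nu> (Q (D j \<psi>)) * \<xi> j \<psi> \<omega>"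
    using \<xi>(3) by (intro AE_finite_allI Fs\<delta>_finite) auto
  have AE_lin: "AE \<omega> in M. \<forall>\<phi>\<in>F\<delta>.
      W (Q \<phi>) \<omega> - W (Q \<eta>) \<omega> = (\<Sum>j\<in>?J. W (Q (D j (dec \<phi> j))) \<omega>)"
  proof (intro AE_finite_allI F\<delta>_finite)
    fix \<phi> assume \<phi>: "\<phi> \<in> F\<delta>"
    have "AE \<omega> in M. W (Q (\<lambda>x. \<phi> x - \<eta> x)) \<omega> = W (Q \<phi>) \<omega> - W (Q \<eta>) \<omega>"
      by (intro white_noise_adjoint_diff[OF noise Q T] F\<delta>_L2 \<phi> \<eta>)
    moreover have "AE \<omega> in M. W (Q (\<lambda>x. \<phi> x - \<eta> x)) \<omega> = (\<Sum>j\<in>?J. W (Q (D j (dec \<phi> j))) \<omega>)"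
      unfolding D_sum[OF \<phi>] using dec(2)[OF \<phi>]
      by (intro white_noise_adjoint_sum[OF noise Q T] D_L2) auto
    ultimately show "AE \<omega> in M. W (Q \<phi>) \<omega> - W (Q \<eta>) \<omega> = (\<Sum>j\<in>?J. W (Q (D j (dec \<phi> j))) \<omega>)"
      by eventually_elim simp
  qed

  \<comment> \<open>Almost sure bound on the loss\<close>
  let ?B = "\<lambda>\<omega>. 3 * \<delta>\<^sup>2 + 8 * inverse c * inverse (real n) * (\<Sum>j\<in>?J. (\<rho> j)\<^sup>2 * G j \<omega>)"
  have AE_bound: "AE \<omega> in M. (L2norm lebesgue (\<lambda>x. fhat \<omega> x - f x))\<^sup>2 \<le> ?B \<omega>"
    using AE_\<xi> AE_lin AE_space
  proof eventually_elim
    case (elim \<omega>)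
    define \<phi> where "\<phi> = fhat \<omega>"
    have \<phi>: "\<phi> \<in> F\<delta>"
      using measurable_space[OF fhat_rv elim(3)] by (simp add: \<phi>_def)
    define a where "a = (L2norm lebesgue (\<lambda>x. \<phi> x - f x))\<^sup>2"
    define t where "t = (L2norm lebesgue (\<lambda>x. \<phi> x - \<eta> x))\<^sup>2"
    define X where "X j = W (Q (D j (dec \<phi> j))) \<omega>" for j
    define u where "u j = L2norm lebesgue (D j (dec \<phi> j))" for j
    \<comment> \<open>Minimality is used against \<eta>; the squared norm of \<open>f\<close> is
      common to both risks and cancels.\<close>
    have "a - 2 * r * W (Q \<phi>) \<omega>
        \<le> (L2norm lebesgue (\<lambda>x. \<eta> x - f x))\<^sup>2 - 2 * r * W (Q \<eta>) \<omega>"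
      using fhat_min[OF elim(3) \<eta>]
        empirical_risk_eq[OF A' A_inv Q f_L2 F\<delta>_L2[OF \<phi>], of W n \<omega>]
        empirical_risk_eq[OF A' A_inv Q f_L2 F\<delta>_L2[OF \<eta>], of W n \<omega>]
      unfolding a_def \<phi>_def r_def by simp
    then have "a \<le> \<delta>\<^sup>2 + 2 * r * (W (Q \<phi>) \<omega> - W (Q \<eta>) \<omega>)"
      using \<eta>_near2 unfolding swap by (simp add: algebra_simps)
    also have "W (Q \<phi>) \<omega> - W (Q \<eta>) \<omega> = (\<Sum>j\<in>?J. X j)"
      using elim(2) \<phi> by (simp add: X_def)
    finally have a_le: "a \<le> \<delta>\<^sup>2 + (\<Sum>j\<in>?J. 2 * (r * X j))"
      by (simp add: sum_distrib_left mult.assoc)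
    \<comment> \<open>Young's inequality separates the random norm \<open>u j\<close>, which will be
      absorbed, from the noise factor, whose square is controlled by \<open>G j\<close> whatever
      component the minimizer has.\<close>
    have X_le: "2 * (r * X j) \<le> c / 4 * (u j)\<^sup>2 + 4 / c * (inverse (real n) * ((\<rho> j)\<^sup>2 * G j \<omega>))"
      if j: "j \<in> ?J" for j
    proof -
      let ?x = "\<bar>\<xi> j (dec \<phi> j) \<omega>\<bar>"
      note m = dec(2)[OF \<phi> j]
      have "X j = L2norm \<nu> (Q (D j (dec \<phi> j))) * \<xi> j (dec \<phi> j) \<omega>"
        using elim(1) j m by (simp add: X_def)
      also have "\<dots> \<le> L2norm \<nu> (Q (D j (dec \<phi> j))) * ?x"
        by (intro mult_left_mono) auto
      also have "\<dots> \<le> (\<rho> j * u j) * ?x"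
        unfolding u_def by (intro mult_right_mono \<rho>_bound j m) auto
      finally have "r * X j \<le> r * ((\<rho> j * u j) * ?x)"
        using r(1) by (rule mult_left_mono)
      then have "2 * (r * X j) \<le> 2 * (u j * (r * \<rho> j * ?x))"
        by (simp add: algebra_simps)
      also have "\<dots> \<le> c / 4 * (u j)\<^sup>2 + 4 / c * (r * \<rho> j * ?x)\<^sup>2"
        by (rule young_quarter[OF c_pos])
      also have "(r * \<rho> j * ?x)\<^sup>2 = inverse (real n) * ((\<rho> j)\<^sup>2 * (\<xi> j (dec \<phi> j) \<omega>)\<^sup>2)"
        by (simp add: power_mult_distrib r(2) mult.assoc)
      also have "c / 4 * (u j)\<^sup>2 + 4 / c * \<dots>
          \<le> c / 4 * (u j)\<^sup>2 + 4 / c * (inverse (real n) * ((\<rho> j)\<^sup>2 * G j \<omega>))"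
        using c_pos by (intro add_left_mono mult_left_mono \<xi>_le_G j m) auto
      finally show ?thesis .
    qed
    \<comment> \<open>The constant \<open>c\<close> enters here: each
      \<open>D j (dec \<phi> j)\<close> is a difference of two elements of
      \<open>Fs j\<close>.\<close>
    have "c * (\<Sum>j\<in>?J. (u j)\<^sup>2)
        \<le> (L2norm lebesgue (\<lambda>x. \<Sum>j=1..p. (\<lambda>j. D j (dec \<phi> j)) j x))\<^sup>2"
      unfolding u_def
    proof (rule c_bound, rule ballI)
      fix j assume j: "j \<in> ?J"
      then have "dec \<phi> j \<in> Fs j" "dec \<eta> j \<in> Fs j"
        using dec(2) \<phi> \<eta> Fs\<delta>_sub by blast+
      then show "\<exists>u\<in>Fs j. \<exists>v\<in>Fs j. D j (dec \<phi> j) = (\<lambda>x. u x - v x)"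
        unfolding D_def by blast
    qed
    also have "\<dots> = t"
      unfolding t_def D_sum[OF \<phi>] ..
    finally have u_le: "c / 4 * (\<Sum>j\<in>?J. (u j)\<^sup>2) \<le> t / 4" by simp
    have "t \<le> 2 * a + 2 * (L2norm lebesgue (\<lambda>x. f x - \<eta> x))\<^sup>2"
      unfolding t_def a_def by (intro L2norm_diff_square_le F\<delta>_L2 f_L2 \<phi> \<eta>)
    then have t_le: "t \<le> 2 * a + 2 * \<delta>\<^sup>2" using \<eta>_near2 by simp
    have "(\<Sum>j\<in>?J. 2 * (r * X j))
        \<le> (\<Sum>j\<in>?J. c / 4 * (u j)\<^sup>2 + 4 / c * (inverse (real n) * ((\<rho> j)\<^sup>2 * G j \<omega>)))"
      by (intro sum_mono X_le)
    also have "\<dots> = c / 4 * (\<Sum>j\<in>?J. (u j)\<^sup>2)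
        + 4 * inverse c * inverse (real n) * (\<Sum>j\<in>?J. (\<rho> j)\<^sup>2 * G j \<omega>)"
      by (simp only: sum.distrib sum_distrib_left divide_inverse mult.assoc)
    finally have "a \<le> \<delta>\<^sup>2 + t / 4
        + 4 * inverse c * inverse (real n) * (\<Sum>j\<in>?J. (\<rho> j)\<^sup>2 * G j \<omega>)"
      using a_le u_le by linarith
    \<comment> \<open>Here t/4 \<le> a/2 + \<delta>^2/2. Moving a/2 to the left and doubling turns
      3/2 into the factor 3 of \<delta>^2 and 4 into the 8 before the noise term.\<close>
    then have "a \<le> ?B \<omega>" using t_le by linarith
    then show ?case unfolding a_def \<phi>_def .
  qed

  \<comment> \<open>Passing to expectations\<close>
  have sum_integrable: "integrable M (\<lambda>\<omega>. \<Sum>j\<in>?J. (\<rho> j)\<^sup>2 * G j \<omega>)"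
    by (intro Bochner_Integration.integrable_sum integrable_mult_right G_integrable)
  have sum_mean: "(\<integral>\<omega>. (\<Sum>j\<in>?J. (\<rho> j)\<^sup>2 * G j \<omega>) \<partial>M) = (\<Sum>j\<in>?J. (\<rho> j)\<^sup>2 * expectation (G j))"
    by (subst Bochner_Integration.integral_sum) (auto intro: G_integrable)
  have "(\<integral>\<omega>. (L2norm lebesgue (\<lambda>x. fhat \<omega> x - f x))\<^sup>2 \<partial>M) \<le> (\<integral>\<omega>. ?B \<omega> \<partial>M)"
  \<comment> \<open>The rule asks for integrability of the majorant only: a non-integrable left side
    would have integral 0, which is covered by \<open>?B\<close> being nonnegative.\<close>
  proof (rule integral_mono_AE'[OF _ AE_bound])
    show "integrable M ?B"
      using sum_integrable by simp
    show "AE \<omega> in M. 0 \<le> ?B \<omega>"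
      using G_nonneg c_pos by (auto intro!: AE_I2 add_nonneg_nonneg mult_nonneg_nonneg sum_nonneg)
  qed
  also have "\<dots> = 3 * \<delta>\<^sup>2
      + 8 * inverse c * inverse (real n) * (\<Sum>j\<in>?J. (\<rho> j)\<^sup>2 * expectation (G j))"
    using sum_integrable sum_mean by (simp add: prob_space)
  also have "\<dots> \<le> 3 * \<delta>\<^sup>2
      + 8 * inverse c * inverse (real n) * (\<Sum>j\<in>?J. (\<rho> j)\<^sup>2 * (4 * (lam j + 1)))"
    using c_pos by (intro add_left_mono mult_left_mono sum_mono G_mean) auto
  also have "\<dots> = 3 * \<delta>\<^sup>2 + 32 * inverse c * inverse (real n) *
      ((\<Sum>j\<in>?J. (\<rho> j)\<^sup>2 * lam j) + (\<Sum>j\<in>?J. (\<rho> j)\<^sup>2))"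
    by (simp add: sum_distrib_left sum.distrib algebra_simps)
  also have "\<dots> \<le> 3 * \<delta>\<^sup>2 + 32 * inverse c * inverse (real n) *
      ((\<Sum>j\<in>?J. (\<rho> j)\<^sup>2 * lam j) + (\<Sum>j\<in>?J. \<rho> j)\<^sup>2)"
  proof -
    \<comment> \<open>Each \<rho>_j is at most the sum of all, because they are nonnegative; so the
      sum of squares obtained so far is bounded by the square of the sum.\<close>
    have "(\<Sum>j\<in>?J. (\<rho> j)\<^sup>2) \<le> (\<Sum>j\<in>?J. \<rho> j * (\<Sum>j\<in>?J. \<rho> j))"
      unfolding power2_eq_square
      by (intro sum_mono mult_left_mono member_le_sum \<rho>_nonneg) (auto intro: \<rho>_nonneg)
    then have "(\<Sum>j\<in>?J. (\<rho> j)\<^sup>2) \<le> (\<Sum>j\<in>?J. \<rho> j)\<^sup>2"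
      by (simp add: power2_eq_square sum_distrib_right)
    then show ?thesis
      using c_pos by (intro add_left_mono mult_left_mono) auto
  qed
  finally show ?thesis .
qed

end
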